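(* Let $\theta_{UNC}=\{UPU,\,UPR,\,RPU\}$, a set of meta-paths of the tripartite preference graph (TPG), and let $g_{UNC}$ be the projection of TPG over $\theta_{UNC}$. Then the set of all recommendation meta-paths (from $U$ to $R$) in $g_{UNC}$, each read as a meta-path of TPG by expanding every edge of the schema of $g_{UNC}$ into the meta-path of $\theta_{UNC}$ it represents, is equal to the set of all meta-paths described by the string description $$strdesc_{UNC}=(UPU\,|\,UPRPU)^*PR .$$
   Context: TPG schema. The tripartite preference graph (TPG) is a graph with three node types: $U$ (users), $P$ (pairwise preferences), $R$ (item representatives). Its undirected edges join users to preferences and preferences to representatives. Its network schema is therefore the directed graph on the vertex set $\{U,P,R\}$ with edges $(U,P),(P,U),(P,R),(R,P)$. Meta-paths. A meta-path of a network is a walk $v_1v_2\cdots v_n$ ($n\ge 1$) in its network schema, i.e. each $(v_i,v_{i+1})$ is an edge of the schema; it is written as the string $v_1v_2\cdots v_n$. A recommendation meta-path (for the query $(U,R)$) is a meta-path with $v_1=U$ and $v_n=R$. Projection. The projection of TPG over a finite set $\theta$ of meta-paths of TPG is a graph whose network schema has as vertices the starting and ending node types of the members of $\theta$, and as edges the pairs $(\pi.\mathrm{start},\pi.\mathrm{end})$ for $\pi\in\theta$. The edge $(\pi.\mathrm{start},\pi.\mathrm{end})$ represents the meta-path $\pi$ of TPG. For the $\theta$ used here, distinct members of $\theta$ give distinct edges. A meta-path of the projection is expanded into a meta-path of TPG by replacing each edge by the meta-path in $\theta$ that it represents and joining these consecutively. String descriptions. A string description denotes a set of strings over the node types. The join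 of strings $\alpha=t_1\cdots t_m$ and $\beta=t'_1\cdots t'_n$ is defined when $t_m=t'_1$ and is $\alpha.\beta=t_1\cdots t_m t'_2\cdots t'_n$ (the shared node type is written once); joins of sets of strings are taken elementwise. The selection $\alpha|\beta$ denotes the set of alternatives $\{\alpha,\beta\}$. If all strings of a set $A$ start and end with the same type $t$, then $A^*$ is the set of all joins of $k\ge 0$ strings from $A$, where the join of $0$ strings is the one-letter string $t$. The expression $(UPU|UPRPU)^*PR$ abbreviates the join $(UPU|UPRPU)^*.\,UPR$, i.e. the strings obtained by appending $PR$ to a string of $(UPU|UPRPU)^*$. *)

theory Defs
  imports "Graph_Theory.Pair_Digraph" "Graph_Theory.Vertex_Walk"
begin

datatype node_type = U | P | R

text \<open>Undirected edge kinds of the TPG appear in both orientations in its network schema.\<close>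

definition tpg_schema :: "node_type pair_pre_digraph" where
  "tpg_schema = \<lparr> pverts = {U, P, R}, parcs = {(U, P), (P, U), (P, R), (R, P)} \<rparr>"

text \<open>Strings \<open>v\<^sub>1 v\<^sub>2 \<dots> v\<^sub>n\<close> are lists; \<^const>\<open>vwalk\<close> requires \<open>n \<ge> 1\<close>.\<close>

definition meta_paths :: "'a pair_pre_digraph \<Rightarrow> 'a list set" where
  "meta_paths S = {p. vwalk p (with_proj S)}"

definition recommendation_meta_paths :: "node_type pair_pre_digraph \<Rightarrow> node_type list set" where
  "recommendation_meta_paths S = {p \<in> meta_paths S. hd p = U \<and> last p = R}"

definition ends :: "'a list \<Rightarrow> 'a \<times> 'a" where
  "ends p = (hd p, last p)"

text \<open>
  Projections enter only through their network schema.
  Intended for a finite set \<open>\<theta>\<close> of meta-paths on which \<^const>\<open>ends\<close> is injective.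
\<close>

definition projection_schema :: "'a list set \<Rightarrow> 'a pair_pre_digraph" where
  "projection_schema \<theta> = \<lparr> pverts = hd ` \<theta> \<union> last ` \<theta>, parcs = ends ` \<theta> \<rparr>"

definition represented_path :: "'a list set \<Rightarrow> 'a \<times> 'a \<Rightarrow> 'a list" where
  "represented_path \<theta> e = (THE p. p \<in> \<theta> \<and> ends p = e)"

text \<open>
  \<^const>\<open>vwalk_join\<close> writes the shared node type once; it is meaningful only if
  \<^const>\<open>joinable\<close> holds. A walk without edges is its own expansion.
\<close>

fun expand :: "'a list set \<Rightarrow> 'a list \<Rightarrow> 'a list" where
  "expand \<theta> [] = []"
| "expand \<theta> [v] = [v]"
| "expand \<theta> (v # w # vs) = vwalk_join (represented_path \<theta> (v, w)) (expand \<theta> (w # vs))"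

definition join_sets :: "'a list set \<Rightarrow> 'a list set \<Rightarrow> 'a list set" where
  "join_sets A B = {vwalk_join a b | a b. a \<in> A \<and> b \<in> B \<and> joinable a b}"

text \<open>
  If all strings of the nonempty set \<open>A\<close> start and end with the same type \<open>t\<close>, then
  \<open>join_power A 0 = {[t]}\<close>.
\<close>

primrec join_power :: "'a list set \<Rightarrow> nat \<Rightarrow> 'a list set" where
  "join_power A 0 = (\<lambda>a. [hd a]) ` A"
| "join_power A (Suc k) = join_sets A (join_power A k)"

datatype 'a strdesc =
    Str "'a list"
  | Join "'a strdesc" "'a strdesc"
  | Sel "'a strdesc" "'a strdesc"
  | Star "'a strdesc"

primrec described :: "'a strdesc \<Rightarrow> 'a list set" where
  "described (Str s) = {s}"
| "described (Join d e) = join_sets (described d) (described e)"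
| "described (Sel d e) = described d \<union> described e"
| "described (Star d) = (\<Union>k. join_power (described d) k)"

definition theta_UNC :: "node_type list set" where
  "theta_UNC = {[U, P, U], [U, P, R], [R, P, U]}"

definition g_UNC_schema :: "node_type pair_pre_digraph" where
  "g_UNC_schema = projection_schema theta_UNC"

definition strdesc_UNC :: "node_type strdesc" where
  "strdesc_UNC = Join (Star (Sel (Str [U, P, U]) (Str [U, P, R, P, U]))) (Str [U, P, R])"

lemma finite_theta_UNC: "finite theta_UNC"
  by (simp add: theta_UNC_def)

lemma theta_UNC_meta_paths: "theta_UNC \<subseteq> meta_paths tpg_schema"
  by (auto simp: theta_UNC_def meta_paths_def tpg_schema_def vwalk_def)

lemma inj_on_ends_theta_UNC: "inj_on ends theta_UNC"
  by (auto simp: theta_UNC_def ends_def inj_on_def)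

lemma represented_path_ends:
  assumes "inj_on ends \<theta>" "p \<in> \<theta>"
  shows "represented_path \<theta> (ends p) = p"
  unfolding represented_path_def using assms by (auto dest: inj_onD)

text \<open>Expansion turns meta-paths of a projection into meta-paths of the underlying network.\<close>

lemma expand_meta_paths:
  assumes "\<theta> \<subseteq> meta_paths S" "inj_on ends \<theta>" "p \<in> meta_paths (projection_schema \<theta>)"
  shows "expand \<theta> p \<in> meta_paths S \<and> ends (expand \<theta> p) = ends p"
proof -
  have "vwalk p (with_proj (projection_schema \<theta>))"
    using assms(3) by (simp add: meta_paths_def)
  then show ?thesis
  proof (induction p)
    case (Base u)
    then obtain q where "q \<in> \<theta>" and u: "u = hd q \<or> u = last q"
      by (auto simp: projection_schema_def)
    then have "vwalk q (with_proj S)"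
      using assms(1) by (auto simp: meta_paths_def)
    with u have "u \<in> pverts S"
      by (auto simp: vwalk_def)
    then show ?case
      by (simp add: meta_paths_def vwalk_def ends_def)
  next
    case (Cons u v es)
    then obtain q where q: "q \<in> \<theta>" "ends q = (u, v)"
      by (auto simp: projection_schema_def)
    then have rep: "represented_path \<theta> (u, v) = q"
      using represented_path_ends[OF assms(2)] by metis
    have wq: "vwalk q (with_proj S)"
      using q assms(1) by (auto simp: meta_paths_def)
    have wr: "vwalk (expand \<theta> (v # es)) (with_proj S)"
      and er: "hd (expand \<theta> (v # es)) = v" "last (expand \<theta> (v # es)) = last (v # es)"
      using Cons.IH by (auto simp: meta_paths_def ends_def)
    have j: "joinable q (expand \<theta> (v # es))"
      using wq wr er q by (auto simp: joinable_def ends_def vwalk_def)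
    show ?case
      using vwalk_joinI_vwalk[OF wq wr j] vwalk_join_hd[OF j] vwalk_join_last[OF j] er q(2)
      by (simp add: rep meta_paths_def ends_def)
  qed
qed

end

(* Since RR is not an edge of the schema of g_UNC, a walk from U to R in it is a sequence of loops
   UU and round trips URU followed by a final step UR. These pieces expand to UPU, UPRPU and UPR. *)
theory Submission
  imports Defs
begin

text \<open>Both sides obey the same recursion. A walk from \<open>U\<close> to \<open>R\<close> in
  the schema either is the single edge \<open>UR\<close>, or opens with \<open>UU\<close> or
  \<open>URU\<close> and goes on from the last \<open>U\<close> of that opening as a shorter such
  walk. Expansion turns the two openings into the prefixes \<open>UP\<close> and \<open>UPRP\<close>
  (\<open>expand_UNC_prepend\<close>). The described strings arise from \<open>UPR\<close> by
  putting the same two prefixes in front (\<open>join_power_UNC_loops_Suc\<close>,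
  \<open>described_strdesc_UNC\<close>). Induction on the length of the walk gives one inclusion
  (\<open>expand_in_described_UNC\<close>), induction on the number of starred pieces the other
  (\<open>join_power_UNC_loops_expand\<close>).\<close>

lemma represented_path_theta_UNC [simp]:
  "represented_path theta_UNC (U, U) = [U, P, U]"
  "represented_path theta_UNC (U, R) = [U, P, R]"
  "represented_path theta_UNC (R, U) = [R, P, U]"
  using represented_path_ends[OF inj_on_ends_theta_UNC, of "[U, P, U]"]
    represented_path_ends[OF inj_on_ends_theta_UNC, of "[U, P, R]"]
    represented_path_ends[OF inj_on_ends_theta_UNC, of "[R, P, U]"]
  by (simp_all add: theta_UNC_def ends_def)

lemma vwalk_g_UNC_Cons2:
  "vwalk (x # y # xs) (with_proj g_UNC_schema) \<longleftrightarrow>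
    (x, y) \<in> {(U, U), (U, R), (R, U)} \<and> vwalk (y # xs) (with_proj g_UNC_schema)"
  by (auto simp: vwalk_def g_UNC_schema_def projection_schema_def theta_UNC_def ends_def)

lemma pverts_g_UNC: "pverts g_UNC_schema = {U, R}"
  by (auto simp: g_UNC_schema_def projection_schema_def theta_UNC_def)

text \<open>Checks joinability once, so that joins of sets become images under a plain list function
  \<open>f\<close>.\<close>

lemma join_sets_eq:
  assumes "\<And>a b. a \<in> A \<Longrightarrow> b \<in> B \<Longrightarrow> joinable a b \<and> vwalk_join a b = f a b"
  shows "join_sets A B = (\<Union>a\<in>A. f a ` B)"
proof (intro set_eqI iffI)
  fix x assume "x \<in> join_sets A B"
  then show "x \<in> (\<Union>a\<in>A. f a ` B)"
    using assms unfolding join_sets_def by blast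
next
  fix x assume "x \<in> (\<Union>a\<in>A. f a ` B)"
  then obtain a b where "a \<in> A" "b \<in> B" "x = f a b"
    by blast
  then show "x \<in> join_sets A B"
    using assms[of a b] unfolding join_sets_def by (metis (mono_tags, lifting) mem_Collect_eq)
qed

abbreviation UNC_loops :: "node_type list set" where
  "UNC_loops \<equiv> {[U, P, U], [U, P, R, P, U]}"

text \<open>These endpoints make every join with a further piece on the left, or with
  \<open>UPR\<close> on the right, defined.\<close>

lemma join_power_UNC_loops_hd_last:
  "s \<in> join_power UNC_loops k \<Longrightarrow> s \<noteq> [] \<and> hd s = U \<and> last s = U"
proof (induction k arbitrary: s)
  case (Suc k)
  then obtain a b where "a \<in> UNC_loops" "b \<in> join_power UNC_loops k" "joinable a b"
      "s = vwalk_join a b"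
    by (auto simp: join_sets_def)
  with Suc.IH[of b] show ?case
    by (cases b) (auto simp: vwalk_join_def)
qed auto

lemma join_power_UNC_loops_Suc:
  "join_power UNC_loops (Suc k) =
    (\<lambda>s. U # P # s) ` join_power UNC_loops k \<union> (\<lambda>s. U # P # R # P # s) ` join_power UNC_loops k"
proof -
  have "\<exists>t. s = U # t" if "s \<in> join_power UNC_loops k" for s
    using join_power_UNC_loops_hd_last[OF that] by (cases s) auto
  \<comment> \<open>The shared \<open>U\<close> is dropped from \<open>a\<close> rather than from
    \<open>s\<close>, which leaves \<open>s\<close> intact behind a fixed prefix.\<close>
  then have "joinable a s \<and> vwalk_join a s = butlast a @ s"
    if "a \<in> UNC_loops" "s \<in> join_power UNC_loops k" for a s
    using that by (force simp: joinable_def vwalk_join_def)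
  then have "join_power UNC_loops (Suc k) =
      (\<Union>a\<in>UNC_loops. (\<lambda>s. butlast a @ s) ` join_power UNC_loops k)"
    unfolding join_power.simps by (rule join_sets_eq)
  then show ?thesis
    by simp
qed

lemma described_strdesc_UNC:
  "described strdesc_UNC = (\<Union>k. (\<lambda>s. s @ [P, R]) ` join_power UNC_loops k)"
proof -
  have "described strdesc_UNC = join_sets (\<Union>k. join_power UNC_loops k) {[U, P, R]}"
    by (simp add: strdesc_UNC_def insert_commute)
  also have "\<dots> = (\<Union>s\<in>(\<Union>k. join_power UNC_loops k). (\<lambda>r. s @ tl r) ` {[U, P, R]})"
    by (rule join_sets_eq)
      (use join_power_UNC_loops_hd_last in \<open>auto simp: joinable_def vwalk_join_def\<close>)
  also have "\<dots> = (\<Union>k. (\<lambda>s. s @ [P, R]) ` join_power UNC_loops k)"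
    by auto
  finally show ?thesis .
qed

lemma described_UNC_I: "s \<in> join_power UNC_loops k \<Longrightarrow> s @ [P, R] \<in> described strdesc_UNC"
  unfolding described_strdesc_UNC by blast

lemma UPR_in_described_UNC: "[U, P, R] \<in> described strdesc_UNC"
  using described_UNC_I[of "[U]" 0] by simp

text \<open>One more starred piece at the front raises the exponent \<open>k\<close> by one.\<close>

lemma described_UNC_prepend:
  assumes "s \<in> described strdesc_UNC"
  shows "U # P # s \<in> described strdesc_UNC" "U # P # R # P # s \<in> described strdesc_UNC"
proof -
  obtain k t where t: "t \<in> join_power UNC_loops k" "s = t @ [P, R]"
    using assms unfolding described_strdesc_UNC by blast
  then have "U # P # t \<in> join_power UNC_loops (Suc k)"
    "U # P # R # P # t \<in> join_power UNC_loops (Suc k)"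
    unfolding join_power_UNC_loops_Suc by blast+
  from this[THEN described_UNC_I] show "U # P # s \<in> described strdesc_UNC"
    "U # P # R # P # s \<in> described strdesc_UNC"
    by (simp_all add: t(2))
qed

lemma expand_Cons_hd: "\<exists>t. expand theta_UNC (U # vs) = U # t"
  if "vwalk (U # vs) (with_proj g_UNC_schema)"
  using that by (cases vs) (auto simp: vwalk_g_UNC_Cons2 vwalk_join_def)

lemma expand_UNC_prepend:
  assumes "vwalk (U # vs) (with_proj g_UNC_schema)"
  shows "expand theta_UNC (U # U # vs) = U # P # expand theta_UNC (U # vs)"
    "expand theta_UNC (U # R # U # vs) = U # P # R # P # expand theta_UNC (U # vs)"
  using expand_Cons_hd[OF assms] by (auto simp: vwalk_join_def)

lemma expand_in_described_UNC:
  assumes "vwalk p (with_proj g_UNC_schema)" "hd p = U" "last p = R"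
  shows "expand theta_UNC p \<in> described strdesc_UNC"
  using assms
\<comment> \<open>Structural induction would not do: a round trip \<open>URU\<close> consumes two
  edges at once.\<close>
proof (induction p rule: length_induct)
  case (1 p)
  \<comment> \<open>The endpoints \<open>U\<close> and \<open>R\<close> differ, so the walk has an
    edge.\<close>
  then obtain x vs where p: "p = U # x # vs"
    by (cases p; cases "tl p") (auto simp: vwalk_def)
  with "1.prems" have w: "vwalk (x # vs) (with_proj g_UNC_schema)" and x: "x = U \<or> x = R"
    by (auto simp: vwalk_g_UNC_Cons2)
  show ?case
  proof (cases x)
    case U
    with w have "vwalk (U # vs) (with_proj g_UNC_schema)"
      by simp
    moreover from this have "expand theta_UNC (U # vs) \<in> described strdesc_UNC"
      using "1.IH" "1.prems"(3) p U by simp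
    ultimately show ?thesis
      by (simp only: p U expand_UNC_prepend described_UNC_prepend)
  next
    case R
    show ?thesis
    proof (cases vs)
      case Nil
      then show ?thesis
        by (simp add: p R vwalk_join_def UPR_in_described_UNC)
    next
      case (Cons y ws)
      \<comment> \<open>The only edge leaving \<open>R\<close> is \<open>RU\<close>.\<close>
      then have y: "y = U" and wy: "vwalk (U # ws) (with_proj g_UNC_schema)"
        using w R by (auto simp: vwalk_g_UNC_Cons2)
      moreover from this have "expand theta_UNC (U # ws) \<in> described strdesc_UNC"
        using "1.IH" "1.prems"(3) p R Cons by simp
      ultimately show ?thesis
        by (simp only: p R Cons expand_UNC_prepend described_UNC_prepend)
    qed
  qed (use x in auto)
qed

lemma join_power_UNC_loops_expand:
  "s \<in> join_power UNC_loops k \<Longrightarrow>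
    \<exists>vs. vwalk (U # vs) (with_proj g_UNC_schema) \<and> last (U # vs) = R \<and>
      expand theta_UNC (U # vs) = s @ [P, R]"
proof (induction k arbitrary: s)
  case 0
  then show ?case
    \<comment> \<open>With no starred piece \<open>s\<close> is the string \<open>U\<close>, and the
      walk \<open>UR\<close> expands to \<open>UPR\<close>.\<close>
    by (intro exI[of _ "[R]"]) (auto simp: vwalk_g_UNC_Cons2 pverts_g_UNC vwalk_join_def)
next
  case (Suc k)
  then obtain t where t: "t \<in> join_power UNC_loops k"
    and s: "s = U # P # t \<or> s = U # P # R # P # t"
    unfolding join_power_UNC_loops_Suc by blast
  obtain vs where vs: "vwalk (U # vs) (with_proj g_UNC_schema)" "last (U # vs) = R"
    "expand theta_UNC (U # vs) = t @ [P, R]"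
    using Suc.IH[OF t] by blast
  have "vwalk (U # U # vs) (with_proj g_UNC_schema)"
    "vwalk (U # R # U # vs) (with_proj g_UNC_schema)"
    using vs(1) by (simp_all add: vwalk_g_UNC_Cons2)
  moreover have "last (U # U # vs) = R" "last (U # R # U # vs) = R"
    using vs(2) by simp_all
  moreover have "expand theta_UNC (U # U # vs) = U # P # t @ [P, R]"
    "expand theta_UNC (U # R # U # vs) = U # P # R # P # t @ [P, R]"
    by (simp_all only: expand_UNC_prepend[OF vs(1)] vs(3))
  ultimately show ?case
    using s by (metis append_Cons)
qed

theorem mainTheorem1:
  shows "expand theta_UNC ` recommendation_meta_paths g_UNC_schema = described strdesc_UNC"
proof
  show "expand theta_UNC ` recommendation_meta_paths g_UNC_schema \<subseteq> described strdesc_UNC"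
    by (auto simp: recommendation_meta_paths_def meta_paths_def intro: expand_in_described_UNC)
next
  show "described strdesc_UNC \<subseteq> expand theta_UNC ` recommendation_meta_paths g_UNC_schema"
  proof
    fix x assume "x \<in> described strdesc_UNC"
    then obtain k s where "s \<in> join_power UNC_loops k" "x = s @ [P, R]"
      by (auto simp: described_strdesc_UNC)
    then obtain vs where "vwalk (U # vs) (with_proj g_UNC_schema)" "last (U # vs) = R"
      "x = expand theta_UNC (U # vs)"
      using join_power_UNC_loops_expand by metis
    then show "x \<in> expand theta_UNC ` recommendation_meta_paths g_UNC_schema"
      by (intro image_eqI[of _ _ "U # vs"])
        (auto simp: recommendation_meta_paths_def meta_paths_def)
  qed
qed

end
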